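(* Let $g\in\mathbb{R}^n\setminus\{0\}$, let $H$ be a real symmetric $n\times n$ matrix, and let $\rho:\mathbb{R}\to[0,\infty]$ be a proper closed convex function with $\rho(0)=0$. Suppose that: (1) $\rho$ is nondecreasing, $\rho(t)=0$ for all $t\le 0$, and there exists $t_0>0$ with $\rho(t_0)<\infty$; (2) $\lim_{t\to\infty}\rho(t)/t=\infty$; (3) the monotone conjugate $\rho^+$ is differentiable at every $t>0$. For $t\in\mathbb{R}$ let $$\lambda(t):=\lambda_{\min}\left(\begin{bmatrix}t&g^T\\ g&H\end{bmatrix}\right),\qquad \widehat k(t):=\inf_{\gamma\ge 0}\{\rho(\gamma-1)+\gamma\lambda(t)\},$$ let $\bar t:=\lim_{\lambda\uparrow\lambda_{\min}(H)}[\lambda+g^T(H-\lambda I)^{-1}g]\in(-\infty,\infty]$, and let $t^*$ be a maximizer of $\sup_{t\in\mathbb{R}}\{\widehat k(t)-t\}$. Then: (i) If $\lambda(t^* )=0$, then $\lambda_{\min}(H)\ge 0$ and $g\in{\rm Range}(H)$. (ii) If $\lambda(t^* )\ne 0$ and $t^*=\bar t$, then $\lambda(t^* )<0$, $\lambda(t^* )=\lambda_{\min}(H)$ and $g\in{\rm Range}(H-\lambda_{\min}(H)I)$.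
   Context: $\lambda_{\min}(A)$ is the smallest eigenvalue of a real symmetric matrix $A$; $I$ is the identity matrix. The monotone conjugate of $\rho$ is $\rho^+(u):=\sup_{t\ge 0}\{ut-\rho(t)\}$. *)

theory Defs
  imports "HOL-Analysis.Analysis"
begin

definition eigenvalue :: "real^'n^'n \<Rightarrow> real \<Rightarrow> bool"
  where "eigenvalue A l \<longleftrightarrow> (\<exists>v. v \<noteq> 0 \<and> A *v v = l *\<^sub>R v)"

(* Meaningful for symmetric A, which has a nonempty finite set of real eigenvalues. *)
definition lambda_min :: "real^'n^'n \<Rightarrow> real"
  where "lambda_min A = (LEAST l. eigenvalue A l)"

(* The (n+1) x (n+1) matrix [[t, g^T], [g, H]]: index None is the additional first
   row/column, index Some i is the row/column i of H. *)
definition bordered :: "real \<Rightarrow> real^'n \<Rightarrow> real^'n^'n \<Rightarrow> real^'n option^'n option"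
  where "bordered t g H = (\<chi> i j.
    case i of
      None \<Rightarrow> (case j of None \<Rightarrow> t | Some b \<Rightarrow> g $ b)
    | Some a \<Rightarrow> (case j of None \<Rightarrow> g $ a | Some b \<Rightarrow> H $ a $ b))"

(* The epigraph constant of HOL-Analysis only covers real-valued functions. An
   extended-real-valued function is closed (convex) iff its epigraph in the plane is
   closed (convex). *)
definition epi :: "(real \<Rightarrow> ereal) \<Rightarrow> (real \<times> real) set"
  where "epi f = {(x, r). f x \<le> ereal r}"

definition proper_fun :: "(real \<Rightarrow> ereal) \<Rightarrow> bool"
  where "proper_fun f \<longleftrightarrow> (\<forall>x. f x \<noteq> -\<infinity>) \<and> (\<exists>x. f x \<noteq> \<infinity>)"

definition closed_fun :: "(real \<Rightarrow> ereal) \<Rightarrow> bool"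
  where "closed_fun f \<longleftrightarrow> closed (epi f)"

definition convex_fun :: "(real \<Rightarrow> ereal) \<Rightarrow> bool"
  where "convex_fun f \<longleftrightarrow> convex (epi f)"

definition monotone_conjugate :: "(real \<Rightarrow> ereal) \<Rightarrow> real \<Rightarrow> ereal"
  where "monotone_conjugate \<rho> u = (SUP t\<in>{0..}. ereal (u * t) - \<rho> t)"

(* Differentiability of an extended-real-valued function includes finiteness near the
   point, since real_of_ereal maps both infinities to 0. *)
definition ereal_differentiable_at :: "(real \<Rightarrow> ereal) \<Rightarrow> real \<Rightarrow> bool"
  where "ereal_differentiable_at f x \<longleftrightarrow>
    (\<forall>\<^sub>F u in nhds x. \<bar>f u\<bar> \<noteq> \<infinity>) \<and> (\<lambda>u. real_of_ereal (f u)) differentiable (at x)"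

definition lam :: "real^'n \<Rightarrow> real^'n^'n \<Rightarrow> real \<Rightarrow> real"
  where "lam g H t = lambda_min (bordered t g H)"

definition khat :: "(real \<Rightarrow> ereal) \<Rightarrow> real^'n \<Rightarrow> real^'n^'n \<Rightarrow> real \<Rightarrow> ereal"
  where "khat \<rho> g H t = (INF \<gamma>\<in>{0..}. \<rho> (\<gamma> - 1) + ereal (\<gamma> * lam g H t))"

(* The limit is taken in ereal because it may be \<infinity>. It exists since the function of l
   is increasing below lambda_min H, where H - l I is invertible. *)
definition tbar :: "real^'n \<Rightarrow> real^'n^'n \<Rightarrow> ereal"
  where "tbar g H = Lim (at_left (lambda_min H))
    (\<lambda>l. ereal (l + g \<bullet> (matrix_inv (H - l *\<^sub>R mat 1) *v g)))"

end

(* Since rho vanishes on the negative half-line, khat(t) = 0 whenever lambda(t) \<ge> 0; as lambda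
   is 1-Lipschitz, a point with lambda(t) > 0 can be moved to the left with khat unchanged, so it
   is not a maximizer.  Completing the square with (H - l I)^(-1) g shows that the bordered matrix
   at tbar dominates l I for every l < lambda_min(H), hence also lambda_min(H) I.  Finally,
   a vector at which a positive semidefinite form vanishes lies in its kernel: applied to (0, v)
   with v in the kernel of H - lambda I, this makes g orthogonal to that kernel. *)
theory Submission
  imports Defs
begin

section \<open>Symmetric matrices: Rayleigh quotients, smallest eigenvalue, range\<close>

lemma inner_symmetric_matrix:
  fixes A :: "real^'n^'n"
  assumes "transpose A = A"
  shows "x \<bullet> (A *v y) = (A *v x) \<bullet> y"
  using assms by (metis dot_lmul_matrix transpose_matrix_vector)

text \<open>The quadratic vanishes at \<open>s = 0\<close> and so has a minimum there; its
  derivative at that point is \<open>2 * b\<close>.\<close>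

lemma linear_coeff_zero_if_quadratic_nonneg:
  fixes a b :: real
  assumes "\<And>s. 0 \<le> 2 * s * b + s\<^sup>2 * a"
  shows "b = 0"
proof (rule ccontr)
  assume "b \<noteq> 0"
  \<comment> \<open>At \<open>s = - b / c\<close> the quadratic is negative as soon as
    \<open>c > 0\<close> and \<open>2 * c > a\<close>; this \<open>c\<close> satisfies both for
    either sign of \<open>a\<close>.\<close>
  define c where "c = \<bar>a\<bar> + 1"
  have "c > 0" "a < 2 * c" by (auto simp: c_def)
  have "2 * (- b / c) * b + (- b / c)\<^sup>2 * a = b\<^sup>2 * (a - 2 * c) / c\<^sup>2"
    using \<open>c > 0\<close> by (simp add: field_simps power2_eq_square)
  also have "\<dots> < 0"
    using \<open>b \<noteq> 0\<close> \<open>c > 0\<close> \<open>a < 2 * c\<close> by (simp add: divide_neg_pos mult_pos_neg)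
  finally show False using assms[of "- b / c"] by linarith
qed

text \<open>By \<open>lower\<close>, the form of \<open>A\<close> minus \<mu> times the identity is
  nonnegative, so \<open>v\<close> is one of its minimizers and the gradient, twice the residual
  \<open>r\<close>, must vanish there.\<close>

lemma eigenvector_if_rayleigh_minimal:
  fixes A :: "real^'n^'n"
  assumes sym: "transpose A = A"
    and lower: "\<And>x. \<mu> * (x \<bullet> x) \<le> x \<bullet> (A *v x)"
    and eq: "v \<bullet> (A *v v) = \<mu> * (v \<bullet> v)"
  shows "A *v v = \<mu> *\<^sub>R v"
proof -
  define r where "r = A *v v - \<mu> *\<^sub>R v"
  \<comment> \<open>Perturbing \<open>v\<close> in the direction of its own residual makes the
    linear coefficient equal to \<open>r \<bullet> r\<close>.\<close>
  have "0 \<le> 2 * s * (r \<bullet> r) + s\<^sup>2 * (r \<bullet> (A *v r) - \<mu> * (r \<bullet> r))" for s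
  proof -
    have "v \<bullet> (A *v r) = r \<bullet> (A *v v)"
      by (metis inner_commute inner_symmetric_matrix sym)
    then have "(v + s *\<^sub>R r) \<bullet> (A *v (v + s *\<^sub>R r)) - \<mu> * ((v + s *\<^sub>R r) \<bullet> (v + s *\<^sub>R r))
      = 2 * s * (r \<bullet> (A *v v) - \<mu> * (r \<bullet> v)) + s\<^sup>2 * (r \<bullet> (A *v r) - \<mu> * (r \<bullet> r))"
      using eq
      by (simp add: matrix_vector_right_distrib matrix_vector_mult_scaleR inner_left_distrib
          inner_right_distrib inner_commute[of v r] algebra_simps power2_eq_square)
    moreover have "r \<bullet> (A *v v) - \<mu> * (r \<bullet> v) = r \<bullet> r"
      by (simp add: r_def inner_diff_right)
    ultimately show ?thesis using lower[of "v + s *\<^sub>R r"] by simp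
  qed
  then have "r \<bullet> r = 0" by (rule linear_coeff_zero_if_quadratic_nonneg)
  then show ?thesis by (simp add: r_def)
qed

text \<open>The form attains a minimum on the compact unit sphere, and a minimizer is an
  eigenvector. Every eigenvalue is the Rayleigh quotient of its eigenvector, so the minimum is the
  least eigenvalue and \<open>LEAST\<close> picks it.\<close>

lemma lambda_min_symmetric:
  fixes A :: "real^'n^'n"
  assumes sym: "transpose A = A"
  shows eigenvalue_lambda_min: "eigenvalue A (lambda_min A)"
    and lambda_min_le_rayleigh: "lambda_min A * (x \<bullet> x) \<le> x \<bullet> (A *v x)"
proof -
  have "continuous_on (sphere (0::real^'n) 1) (\<lambda>x. x \<bullet> (A *v x))"
    by (intro continuous_intros linear_continuous_on matrix_vector_mul_bounded_linear)
  then obtain v where v: "norm v = 1" and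
    min: "\<And>x. norm x = 1 \<Longrightarrow> v \<bullet> (A *v v) \<le> x \<bullet> (A *v x)"
    using continuous_attains_inf[of "sphere (0::real^'n) 1" "\<lambda>x. x \<bullet> (A *v x)"]
    by (auto simp: sphere_eq_empty)
  define \<mu> where "\<mu> = v \<bullet> (A *v v)"
  have lower: "\<mu> * (x \<bullet> x) \<le> x \<bullet> (A *v x)" for x
  proof (cases "x = 0")
    case False
    define y where "y = x /\<^sub>R norm x"
    have "norm y = 1" and x: "x = norm x *\<^sub>R y" using False by (auto simp: y_def)
    have "x \<bullet> (A *v x) = (norm x)\<^sup>2 * (y \<bullet> (A *v y))"
      by (subst x, subst (2) x) (simp add: matrix_vector_mult_scaleR power2_eq_square)
    then show ?thesis
      using min[OF \<open>norm y = 1\<close>]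
      by (simp add: \<mu>_def dot_square_norm mult.commute[of "(norm x)\<^sup>2"] mult_right_mono)
  qed simp
  have "A *v v = \<mu> *\<^sub>R v"
    using v by (intro eigenvector_if_rayleigh_minimal[OF sym lower])
      (simp add: \<mu>_def dot_square_norm)
  then have ev: "eigenvalue A \<mu>"
    using v unfolding eigenvalue_def by (metis norm_zero zero_neq_one)
  have least: "\<mu> \<le> l" if "eigenvalue A l" for l
  proof -
    from that obtain w where "w \<noteq> 0" "A *v w = l *\<^sub>R w" by (auto simp: eigenvalue_def)
    with lower[of w] show ?thesis by simp
  qed
  have "lambda_min A = \<mu>"
    unfolding lambda_min_def using ev least by (rule Least_equality)
  with ev lower show "eigenvalue A (lambda_min A)"
    and "lambda_min A * (x \<bullet> x) \<le> x \<bullet> (A *v x)" by auto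
qed

lemma lambda_min_ge:
  fixes A :: "real^'n^'n"
  assumes "transpose A = A" and "\<And>x. l * (x \<bullet> x) \<le> x \<bullet> (A *v x)"
  shows "l \<le> lambda_min A"
proof -
  obtain v where "v \<noteq> 0" "A *v v = lambda_min A *\<^sub>R v"
    using eigenvalue_lambda_min[OF assms(1)] by (auto simp: eigenvalue_def)
  with assms(2)[of v] show ?thesis by simp
qed

text \<open>For symmetric \<open>A\<close> the orthogonal complement of the range lies in the
  kernel, and a subspace is its own double complement in finite dimension.\<close>

lemma range_symmetric_matrix:
  fixes A :: "real^'n^'n"
  assumes sym: "transpose A = A" and orth: "\<And>v. A *v v = 0 \<Longrightarrow> g \<bullet> v = 0"
  shows "g \<in> range ((*v) A)"
proof -
  have sub: "subspace (range ((*v) A))"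
    by (intro linear_subspace_image matrix_vector_mul_linear subspace_UNIV)
  have "A *v v = 0" if v: "v \<in> orthogonal_comp (range ((*v) A))" for v
  proof -
    \<comment> \<open>Testing \<open>v\<close> against this particular element of the range turns
      orthogonality into \<open>(A *v v) \<bullet> (A *v v) = 0\<close>.\<close>
    have "(A *v (A *v v)) \<bullet> v = 0"
      using v by (auto simp: orthogonal_comp_def orthogonal_def)
    then show ?thesis using inner_symmetric_matrix[OF sym, of "A *v v" v] by simp
  qed
  then have "g \<in> orthogonal_comp (orthogonal_comp (range ((*v) A)))"
    using orth by (auto simp: orthogonal_comp_def[of "orthogonal_comp _"] orthogonal_def inner_commute)
  then show ?thesis using orthogonal_comp_self[OF sub] by simp
qed

section \<open>The quadratic form of the bordered matrix in block coordinates\<close>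

definition border_vec :: "real \<Rightarrow> real^'n \<Rightarrow> real^'n option"
  where "border_vec s x = (\<chi> i. case i of None \<Rightarrow> s | Some a \<Rightarrow> x $ a)"

lemma sum_UNIV_option:
  fixes f :: "'n::finite option \<Rightarrow> 'b::comm_monoid_add"
  shows "sum f UNIV = f None + (\<Sum>a\<in>UNIV. f (Some a))"
  by (simp add: UNIV_option_conv sum.reindex)

lemma border_vec_cases:
  obtains s x where "v = border_vec s x"
proof
  show "v = border_vec (v $ None) (\<chi> a. v $ Some a)"
    by (auto simp: border_vec_def vec_eq_iff split: option.split)
qed

lemma inner_border_vec: "border_vec s x \<bullet> border_vec s' x' = s * s' + x \<bullet> x'"
  by (simp add: inner_vec_def border_vec_def sum_UNIV_option)

lemma bordered_mult_border_vec:
  "bordered t g H *v border_vec s x = border_vec (t * s + g \<bullet> x) (s *\<^sub>R g + H *v x)"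
  by (auto simp: vec_eq_iff matrix_vector_mult_def bordered_def border_vec_def sum_UNIV_option
      inner_vec_def mult.commute split: option.split)

lemma bordered_form:
  "border_vec s x \<bullet> (bordered t g H *v border_vec s x) =
    t * s\<^sup>2 + 2 * s * (g \<bullet> x) + x \<bullet> (H *v x)"
  by (simp add: bordered_mult_border_vec inner_border_vec inner_right_distrib inner_commute
      algebra_simps power2_eq_square)

lemma transpose_bordered:
  assumes "transpose H = H"
  shows "transpose (bordered t g H) = bordered t g H"
proof -
  have "H $ a $ b = H $ b $ a" for a b
    using assms by (metis transpose_def vec_lambda_beta)
  then show ?thesis
    by (auto simp: vec_eq_iff transpose_def bordered_def split: option.split)
qed

lemma lam_le_form:
  assumes "transpose H = H"
  shows "lam g H t * (s\<^sup>2 + x \<bullet> x) \<le> t * s\<^sup>2 + 2 * s * (g \<bullet> x) + x \<bullet> (H *v x)"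
  using lambda_min_le_rayleigh[OF transpose_bordered[OF assms], of t g "border_vec s x"]
  by (simp only: bordered_form inner_border_vec lam_def power2_eq_square)

lemma lam_ge:
  fixes H :: "real^'n^'n"
  assumes "transpose H = H"
    and "\<And>s x. l * (s\<^sup>2 + x \<bullet> x) \<le> t * s\<^sup>2 + 2 * s * (g \<bullet> x) + x \<bullet> (H *v x)"
  shows "l \<le> lam g H t"
  unfolding lam_def
proof (rule lambda_min_ge[OF transpose_bordered[OF assms(1)]])
  fix v :: "real^'n option"
  obtain s x where "v = border_vec s x" by (rule border_vec_cases)
  then show "l * (v \<bullet> v) \<le> v \<bullet> (bordered t g H *v v)"
    using assms(2) by (simp only: bordered_form inner_border_vec power2_eq_square)
qed

text \<open>This is one half of Cauchy interlacing: \<open>H\<close> is a principal submatrix, seen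
  by the test vectors with \<open>s = 0\<close>.\<close>

lemma lam_le_lambda_min:
  assumes sym: "transpose H = H"
  shows "lam g H t \<le> lambda_min H"
  using lam_le_form[OF sym, of g t 0] by (intro lambda_min_ge[OF sym]) simp

text \<open>Lowering the corner entry by \<open>e\<close> costs the form
  \<open>e * s\<^sup>2\<close>, at most \<open>e\<close> times the squared norm of the block
  vector.\<close>

lemma lam_diff_ge:
  fixes H :: "real^'n^'n"
  assumes sym: "transpose H = H" and "0 \<le> e"
  shows "lam g H t - e \<le> lam g H (t - e)"
proof (rule lam_ge[OF sym])
  fix s and x :: "real^'n"
  have "0 \<le> e * (x \<bullet> x)" using \<open>0 \<le> e\<close> by simp
  then show "(lam g H t - e) * (s\<^sup>2 + x \<bullet> x) \<le> (t - e) * s\<^sup>2 + 2 * s * (g \<bullet> x) + x \<bullet> (H *v x)"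
    using lam_le_form[OF sym, of g t s x] by (simp add: algebra_simps)
qed

text \<open>The block vector (0, v) attains the lower bound for the form of the bordered matrix, so
  it satisfies the eigenvalue equation, whose \<open>None\<close> component is the claim.\<close>

lemma orthogonal_eigenvectors_lam:
  assumes sym: "transpose H = H" and ev: "H *v v = lam g H t *\<^sub>R v"
  shows "g \<bullet> v = 0"
proof -
  have "bordered t g H *v border_vec 0 v = lam g H t *\<^sub>R border_vec 0 v"
    unfolding lam_def
  proof (rule eigenvector_if_rayleigh_minimal)
    show "border_vec 0 v \<bullet> (bordered t g H *v border_vec 0 v) =
        lambda_min (bordered t g H) * (border_vec 0 v \<bullet> border_vec 0 v)"
      by (simp add: bordered_form inner_border_vec ev lam_def)
  qed (use sym in \<open>auto intro: transpose_bordered lambda_min_le_rayleigh\<close>)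
  then have "(bordered t g H *v border_vec 0 v) $ None = (lam g H t *\<^sub>R border_vec 0 v) $ None"
    by simp
  then show ?thesis
    by (simp add: bordered_mult_border_vec) (simp add: border_vec_def)
qed

section \<open>Shifts of \<open>H\<close> below its spectrum and the secular function\<close>

lemma transpose_shift:
  fixes H :: "real^'n^'n"
  assumes "transpose H = H"
  shows "transpose (H - l *\<^sub>R mat 1) = H - l *\<^sub>R mat 1"
proof -
  have "H $ a $ b = H $ b $ a" for a b
    using assms by (metis transpose_def vec_lambda_beta)
  then show ?thesis by (auto simp: vec_eq_iff transpose_def mat_def)
qed

lemma shift_mult: "(H - l *\<^sub>R mat 1) *v x = H *v x - l *\<^sub>R x"
  for H :: "real^'n^'n"
  by (simp add: matrix_vector_mult_diff_rdistrib scaleR_matrix_vector_assoc[symmetric])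

text \<open>Both range claims of the theorem are instances: one with \<open>lam g H t = 0\<close>,
  the other with \<open>lam g H t = lambda_min H\<close>.\<close>

lemma range_shift_lam:
  assumes sym: "transpose H = H"
  shows "g \<in> range ((*v) (H - lam g H t *\<^sub>R mat 1))"
  by (rule range_symmetric_matrix[OF transpose_shift[OF sym]])
    (auto simp: shift_mult intro: orthogonal_eigenvectors_lam[OF sym])

lemma shift_form_nonneg:
  assumes sym: "transpose H = H" and "l \<le> lambda_min H"
  shows "0 \<le> x \<bullet> ((H - l *\<^sub>R mat 1) *v x)"
  using lambda_min_le_rayleigh[OF sym, of x] mult_right_mono[OF assms(2), of "x \<bullet> x"]
  by (simp add: shift_mult inner_diff_right)

lemma shift_mult_matrix_inv:
  assumes sym: "transpose H = H" and less: "l < lambda_min H"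
  shows "(H - l *\<^sub>R mat 1) *v (matrix_inv (H - l *\<^sub>R mat 1) *v g) = g"
proof -
  let ?M = "H - l *\<^sub>R mat 1"
  \<comment> \<open>A nonzero kernel vector would have Rayleigh quotient \<open>l\<close>, below the
    minimum \<open>lambda_min H\<close>.\<close>
  have "x = 0" if "?M *v x = 0" for x
  proof (rule ccontr)
    assume "x \<noteq> 0"
    with less have "l * (x \<bullet> x) < lambda_min H * (x \<bullet> x)" by simp
    moreover have "x \<bullet> (H *v x) = l * (x \<bullet> x)" using that by (simp add: shift_mult)
    ultimately show False using lambda_min_le_rayleigh[OF sym, of x] by simp
  qed
  then have "invertible ?M"
    by (simp add: invertible_left_inverse matrix_left_invertible_ker)
  then have "?M ** matrix_inv ?M = mat 1"
    unfolding invertible_def matrix_inv_def by (rule someI2_ex) blast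
  then show ?thesis by (simp add: matrix_vector_mul_assoc)
qed

text \<open>The function whose left limit defines \<open>tbar\<close>. For
  \<open>l < lambda_min H\<close>, \<open>t - secular g H l\<close> is the Schur complement of the
  shifted block of \<open>H\<close> in the bordered matrix minus \<open>l\<close> times the
  identity.\<close>

definition secular :: "real^'n \<Rightarrow> real^'n^'n \<Rightarrow> real \<Rightarrow> real"
  where "secular g H l = l + g \<bullet> (matrix_inv (H - l *\<^sub>R mat 1) *v g)"

text \<open>With \<open>y\<close> solving \<open>M *v y = g\<close>, the right side minus the left
  side is exactly the form of \<open>M\<close> at \<open>x + s *\<^sub>R y\<close>.\<close>

lemma secular_form_ge:
  assumes sym: "transpose H = H" and "l < lambda_min H"
  shows "l * (s\<^sup>2 + x \<bullet> x) \<le> secular g H l * s\<^sup>2 + 2 * s * (g \<bullet> x) + x \<bullet> (H *v x)"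
proof -
  define M where "M = H - l *\<^sub>R mat 1"
  define y where "y = matrix_inv M *v g"
  have My: "M *v y = g" unfolding y_def M_def by (rule shift_mult_matrix_inv[OF assms])
  have "y \<bullet> (M *v x) = g \<bullet> x"
    by (simp add: inner_symmetric_matrix[OF transpose_shift[OF sym, of l, folded M_def]] My)
  then have "(x + s *\<^sub>R y) \<bullet> (M *v (x + s *\<^sub>R y)) =
      s\<^sup>2 * (g \<bullet> y) + 2 * s * (g \<bullet> x) + x \<bullet> (M *v x)"
    by (simp add: matrix_vector_right_distrib matrix_vector_mult_scaleR My inner_left_distrib
        inner_right_distrib inner_commute[of _ g] algebra_simps power2_eq_square)
  then have "0 \<le> s\<^sup>2 * (g \<bullet> y) + 2 * s * (g \<bullet> x) + x \<bullet> (M *v x)"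
    using shift_form_nonneg[OF sym, of l "x + s *\<^sub>R y", folded M_def] assms(2) by simp
  then show ?thesis
    by (simp add: secular_def M_def[symmetric] y_def[symmetric] shift_mult[of H l, folded M_def] inner_diff_right algebra_simps)
qed

lemma secular_mono:
  assumes sym: "transpose H = H" and "l \<le> m" and "m < lambda_min H"
  shows "secular g H l \<le> secular g H m"
proof -
  define y where "y = matrix_inv (H - l *\<^sub>R mat 1) *v g"
  have "(H - l *\<^sub>R mat 1) *v y = g"
    unfolding y_def using assms by (intro shift_mult_matrix_inv) auto
  then have Hy: "H *v y = g + l *\<^sub>R y" by (simp only: shift_mult diff_eq_eq)
  have "0 \<le> (m - l) * (y \<bullet> y)" using assms by simp
  \<comment> \<open>The vector (1, -y) is where the completed square for \<open>l\<close> vanishes.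
    Testing it in the inequality for \<open>m\<close> gives that \<open>secular\<close> grows by at
    least \<open>(m - l) * (1 + y \<bullet> y)\<close>.\<close>
  with secular_form_ge[OF sym assms(3), of 1 "- y" g] assms(2) show ?thesis
    by (simp add: secular_def[of g H l] y_def[symmetric] linear_neg[OF matrix_vector_mul_linear] Hy
        inner_right_distrib inner_commute[of y g] algebra_simps)
qed

text \<open>The left limit of a nondecreasing function is its supremum. In this form a bound on
  \<open>tbar\<close> becomes a bound on \<open>secular\<close> at every single
  \<open>l\<close>.\<close>

lemma tbar_eq_SUP:
  assumes sym: "transpose H = H"
  shows "tbar g H = (SUP l\<in>{..<lambda_min H}. ereal (secular g H l))"
proof -
  have "((\<lambda>l. ereal (secular g H l)) \<longlongrightarrow> (SUP l\<in>{..<lambda_min H}. ereal (secular g H l)))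
      (at_left (lambda_min H))"
  proof (rule increasing_tendsto)
    show "\<forall>\<^sub>F l in at_left (lambda_min H).
        ereal (secular g H l) \<le> (SUP l\<in>{..<lambda_min H}. ereal (secular g H l))"
      by (simp add: eventually_at_filter) (auto intro!: always_eventually SUP_upper)
  next
    fix b assume "b < (SUP l\<in>{..<lambda_min H}. ereal (secular g H l))"
    then obtain l where l: "l < lambda_min H" "b < ereal (secular g H l)"
      by (auto simp: less_SUP_iff)
    have "\<forall>\<^sub>F m in at_left (lambda_min H). m \<in> {l<..<lambda_min H}"
      using l(1) by (rule eventually_at_left_real)
    then show "\<forall>\<^sub>F m in at_left (lambda_min H). b < ereal (secular g H m)"
    proof eventually_elim
      case (elim m)
      with secular_mono[OF sym, of l m g] l(2) show ?case
        by (auto intro: less_le_trans)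
    qed
  qed
  then show ?thesis
    unfolding tbar_def secular_def by (intro tendsto_Lim) auto
qed

lemma lam_eq_lambda_min_if_tbar_le:
  assumes sym: "transpose H = H" and "tbar g H \<le> ereal t"
  shows "lam g H t = lambda_min H"
\<comment> \<open>The shift of \<open>H\<close> is singular at \<open>lambda_min H\<close> itself,
  so the lower bound is proved for every smaller \<open>l\<close>.\<close>
proof (rule antisym[OF lam_le_lambda_min[OF sym]], rule dense_le)
  fix l assume l: "l < lambda_min H"
  then have "ereal (secular g H l) \<le> ereal t"
    using assms(2) by (auto simp: tbar_eq_SUP[OF sym] SUP_le_iff)
  then have "secular g H l * s\<^sup>2 \<le> t * s\<^sup>2" for s by (simp add: mult_right_mono)
  with secular_form_ge[OF sym l] show "l \<le> lam g H t"
    by (intro lam_ge[OF sym]) (smt (verit))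
qed

section \<open>Sign of \<open>lam\<close> at a maximizer, and the conclusion\<close>

lemma khat_eq_0:
  assumes "\<And>t. 0 \<le> \<rho> t" and "\<rho> (- 1) = 0" and "0 \<le> lam g H t"
  shows "khat \<rho> g H t = 0"
  unfolding khat_def
proof (rule antisym)
  show "(INF \<gamma>\<in>{0..}. \<rho> (\<gamma> - 1) + ereal (\<gamma> * lam g H t)) \<le> 0"
    \<comment> \<open>The choice \<gamma> = 0 leaves only \<rho>(-1), which is zero.\<close>
    using assms(2) by (intro INF_lower2[of 0]) (auto simp flip: zero_ereal_def)
  show "0 \<le> (INF \<gamma>\<in>{0..}. \<rho> (\<gamma> - 1) + ereal (\<gamma> * lam g H t))"
    using assms by (intro INF_greatest add_nonneg_nonneg) auto
qed

lemma lam_nonpos_if_arg_max: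
  assumes sym: "transpose H = H" and nonneg: "\<And>t. 0 \<le> \<rho> t" and "\<rho> (- 1) = 0"
    and max: "is_arg_max (\<lambda>t. khat \<rho> g H t - ereal t) (\<lambda>t. True) t"
  shows "lam g H t \<le> 0"
proof (rule ccontr)
  assume pos: "\<not> lam g H t \<le> 0"
  \<comment> \<open>A move to the left by \<open>lam g H t\<close> is the longest for which
    \<open>lam_diff_ge\<close> still guarantees a nonnegative \<open>lam\<close>;
    \<open>khat\<close> stays 0 while the objective gains \<open>lam g H t\<close>.\<close>
  define u where "u = t - lam g H t"
  have "0 \<le> lam g H u"
    using lam_diff_ge[OF sym, of "lam g H t" g t] pos by (simp add: u_def)
  then have "khat \<rho> g H u = 0" "khat \<rho> g H t = 0"
    using assms pos by (auto intro: khat_eq_0)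
  then have "khat \<rho> g H t - ereal t < khat \<rho> g H u - ereal u"
    using pos by (simp add: u_def)
  then show False using max by (auto simp: is_arg_max_def)
qed

theorem theorem3p9:
  fixes g :: "real^'n" and H :: "real^'n^'n" and \<rho> :: "real \<Rightarrow> ereal" and tstar :: real
  assumes "g \<noteq> 0"
    and "transpose H = H"
    and "\<And>t. 0 \<le> \<rho> t"
    and "proper_fun \<rho>" and "closed_fun \<rho>" and "convex_fun \<rho>"
    and "\<rho> 0 = 0"
    and "mono \<rho>" and "\<And>t. t \<le> 0 \<Longrightarrow> \<rho> t = 0" and "\<exists>t0>0. \<rho> t0 < \<infinity>"
    and "((\<lambda>t. \<rho> t / ereal t) \<longlongrightarrow> \<infinity>) at_top"
    and "\<And>t. t > 0 \<Longrightarrow> ereal_differentiable_at (monotone_conjugate \<rho>) t"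
    and "is_arg_max (\<lambda>t. khat \<rho> g H t - ereal t) (\<lambda>t. True) tstar"
  shows "(lam g H tstar = 0 \<longrightarrow> lambda_min H \<ge> 0 \<and> g \<in> range ((*v) H)) \<and>
    (lam g H tstar \<noteq> 0 \<and> ereal tstar = tbar g H \<longrightarrow>
      lam g H tstar < 0 \<and> lam g H tstar = lambda_min H \<and>
      g \<in> range ((*v) (H - lambda_min H *\<^sub>R mat 1)))"
proof (intro conjI impI)
  note sym = \<open>transpose H = H\<close>
  {
    assume "lam g H tstar = 0"
    with lam_le_lambda_min[OF sym, of g tstar] show "lambda_min H \<ge> 0" by simp
  next
    assume "lam g H tstar = 0"
    with range_shift_lam[OF sym, of g tstar] show "g \<in> range ((*v) H)" by simp
  next
    assume "lam g H tstar \<noteq> 0 \<and> ereal tstar = tbar g H"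
    moreover have "lam g H tstar \<le> 0"
      using assms by (intro lam_nonpos_if_arg_max[of H \<rho>]) auto
    ultimately show "lam g H tstar < 0" by simp
  next
    assume "lam g H tstar \<noteq> 0 \<and> ereal tstar = tbar g H"
    then show "lam g H tstar = lambda_min H"
      by (intro lam_eq_lambda_min_if_tbar_le[OF sym]) simp
    with range_shift_lam[OF sym, of g tstar]
    show "g \<in> range ((*v) (H - lambda_min H *\<^sub>R mat 1))" by simp
  }
qed

end
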